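(* Let $f,g,h$ be proper, lower semicontinuous and convex functions on $\mathbb{R}^n$, with $h$ additionally $L$-smooth (differentiable with $L$-Lipschitz gradient). Consider the HJ-Prox-based Davis–Yin splitting algorithm for $f+g+h$, $$y_{k+1}=\operatorname{prox}^{\delta_k}_{tf}(x_k),\qquad z_{k+1}=\operatorname{prox}^{\delta_k}_{tg}\bigl(2y_{k+1}-x_k-t\nabla h(y_{k+1})\bigr),\qquad x_{k+1}=x_k+z_{k+1}-y_{k+1},$$ with $\{\sqrt{\delta_k}\}_{k\ge1}$ a summable sequence ($\delta_k>0$) and $0<t<2/L$. Then $x_k$ converges to a minimizer of $f+g+h$.
   Context: For a function $\varphi$ on $\mathbb{R}^n$, $t>0$ and $\delta>0$, the HJ-Prox of $\varphi$ is the map $$\operatorname{prox}^{\delta}_{t\varphi}(x)=\frac{\mathbb{E}_{y\sim\mathcal{N}(x,\delta tI)}\left[y\,\exp(-\varphi(y)/\delta)\right]}{\mathbb{E}_{y\sim\mathcal{N}(x,\delta tI)}\left[\exp(-\varphi(y)/\delta)\right]},$$ where $\mathcal{N}(x,\delta tI)$ is the Gaussian distribution on $\mathbb{R}^n$ with mean $x$ and covariance matrix $\delta tI$. It is an approximation of the proximal operator $\operatorname{prox}_{t\varphi}(x)=\arg\min_{z}\{\varphi(z)+\frac{1}{2t}\|z-x\|^2\}$. The expectations are evaluated exactly (no Monte Carlo sampling error).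
   Formalization: Corrected: x_k converges to some x' and y_k to prox_{tf}(x'), which minimizes f+g+h (x' itself need not). Added: 0 ∈ ∂f(p)+∂g(p)+∇h(p) for some p, and the HJ-Prox denominators formed by the algorithm are nonzero. *)

theory Defs
  imports "HOL-Analysis.Analysis"
begin

(* Convex functions are extended-valued, with \<infinity> outside the effective domain. *)

definition proper_fun :: "('a \<Rightarrow> ereal) \<Rightarrow> bool" where
  "proper_fun \<phi> \<longleftrightarrow> (\<forall>x. \<phi> x \<noteq> -\<infinity>) \<and> (\<exists>x. \<phi> x \<noteq> \<infinity>)"

definition lsc_fun :: "('a::topological_space \<Rightarrow> ereal) \<Rightarrow> bool" where
  "lsc_fun \<phi> \<longleftrightarrow> (\<forall>x. \<phi> x \<le> Liminf (at x) \<phi>)"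

(* Used only for functions that never take the value -\<infinity>, where the right-hand side is
   unambiguous; the case u = 0 or v = 0 is harmless because 0 * \<infinity> = 0 in ereal. *)
definition convex_fun :: "('a::real_vector \<Rightarrow> ereal) \<Rightarrow> bool" where
  "convex_fun \<phi> \<longleftrightarrow> (\<forall>x y. \<forall>u\<ge>0. \<forall>v\<ge>0. u + v = 1 \<longrightarrow>
      \<phi> (u *\<^sub>R x + v *\<^sub>R y) \<le> ereal u * \<phi> x + ereal v * \<phi> y)"

definition subdifferential :: "('a::real_inner \<Rightarrow> ereal) \<Rightarrow> 'a \<Rightarrow> 'a set" where
  "subdifferential \<phi> x =
     {v. \<bar>\<phi> x\<bar> \<noteq> \<infinity> \<and> (\<forall>y. \<phi> x + ereal (v \<bullet> (y - x)) \<le> \<phi> y)}"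

(* L-smoothness of a finite function h with gradient dh. *)
definition smooth_with :: "real \<Rightarrow> ('a::real_inner \<Rightarrow> real) \<Rightarrow> ('a \<Rightarrow> 'a) \<Rightarrow> bool" where
  "smooth_with L h dh \<longleftrightarrow> (\<forall>x. GDERIV h x :> dh x) \<and> L-lipschitz_on UNIV dh"

definition prox :: "real \<Rightarrow> ('a::real_normed_vector \<Rightarrow> ereal) \<Rightarrow> 'a \<Rightarrow> 'a" where
  "prox t \<phi> x = arg_min (\<lambda>z. \<phi> z + ereal (1 / (2 * t) * (norm (z - x))\<^sup>2)) (\<lambda>_. True)"

(* The normal distribution with mean m and covariance matrix s * I; s is the variance of each
   coordinate, not the standard deviation. *)
definition gaussian :: "'a::euclidean_space \<Rightarrow> real \<Rightarrow> 'a measure" where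
  "gaussian m s = density lborel
     (\<lambda>y. ennreal ((2 * pi * s) powr (- real DIM('a) / 2) * exp (- (norm (y - m))\<^sup>2 / (2 * s))))"

(* exp (- \<phi> y / \<delta>), with the convention exp (-\<infinity>) = 0 *)
definition hj_weight :: "real \<Rightarrow> ('a \<Rightarrow> ereal) \<Rightarrow> 'a \<Rightarrow> real" where
  "hj_weight \<delta> \<phi> y = (if \<phi> y = \<infinity> then 0 else exp (- real_of_ereal (\<phi> y) / \<delta>))"

definition hj_denominator :: "real \<Rightarrow> real \<Rightarrow> ('a::euclidean_space \<Rightarrow> ereal) \<Rightarrow> 'a \<Rightarrow> real" where
  "hj_denominator \<delta> t \<phi> x = (\<integral>y. hj_weight \<delta> \<phi> y \<partial>gaussian x (\<delta> * t))"

definition hj_numerator :: "real \<Rightarrow> real \<Rightarrow> ('a::euclidean_space \<Rightarrow> ereal) \<Rightarrow> 'a \<Rightarrow> 'a" where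
  "hj_numerator \<delta> t \<phi> x = (\<integral>y. hj_weight \<delta> \<phi> y *\<^sub>R y \<partial>gaussian x (\<delta> * t))"

(* Only meaningful where the denominator is nonzero; for a convex \<phi> whose domain is a null set
   it vanishes and the division convention would return 0. *)
definition hj_prox :: "real \<Rightarrow> real \<Rightarrow> ('a::euclidean_space \<Rightarrow> ereal) \<Rightarrow> 'a \<Rightarrow> 'a" where
  "hj_prox \<delta> t \<phi> x = hj_numerator \<delta> t \<phi> x /\<^sub>R hj_denominator \<delta> t \<phi> x"

end

theory Submission
  imports Defs
begin

text \<open>
  For exact proximal steps, one Davis--Yin iteration is an operator \<open>T\<close> satisfying
  \<open>\<parallel>T a - T b\<parallel>\<^sup>2 + (1 - tL/2) \<parallel>(a - T a) - (b - T b)\<parallel>\<^sup>2 \<le> \<parallel>a - b\<parallel>\<^sup>2\<close>, by monotonicity of the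
  subdifferentials and cocoercivity of the gradient (Baillon--Haddad), and its fixed points are
  sent to minimizers by \<open>prox t f\<close>. The HJ-Prox is the mean of the density proportional to
  \<open>exp (- (\<phi>(y) + \<parallel>y - x\<parallel>\<^sup>2 / (2t)) / \<delta>)\<close>, whose mode is the exact prox \<open>p\<close>. Comparing this
  density at \<open>y\<close> and at the midpoint of \<open>p\<close> and \<open>y\<close>, and integrating with the substitution
  \<open>y \<mapsto> (p + y)/2\<close>, bounds the second moment about \<open>p\<close> by a constant times \<open>\<delta>\<close>. Hence every
  iteration equals \<open>T\<close> up to an error of order \<open>sqrt \<delta>\<^sub>k\<close>, which is summable, and the
  Krasnoselskii--Mann argument survives summable errors.
\<close>

subsection \<open>Subdifferentials and proximal points\<close>

lemma subdifferentialD: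
  assumes "v \<in> subdifferential \<phi> p"
  obtains r where "\<phi> p = ereal r" "\<And>y. ereal (r + v \<bullet> (y - p)) \<le> \<phi> y"
proof -
  obtain r where r: "\<phi> p = ereal r"
    using assms by (cases "\<phi> p") (auto simp: subdifferential_def)
  with assms that show ?thesis by (auto simp: subdifferential_def)
qed

lemma subdifferentialI:
  assumes "\<phi> p = ereal r" "\<And>y. ereal (r + v \<bullet> (y - p)) \<le> \<phi> y"
  shows "v \<in> subdifferential \<phi> p"
  using assms by (auto simp: subdifferential_def)

lemma subdifferential_monotone:
  assumes "u \<in> subdifferential \<phi> a" "v \<in> subdifferential \<phi> b"
  shows "(u - v) \<bullet> (a - b) \<ge> 0"
proof -
  obtain r where r: "\<phi> a = ereal r" "\<And>y. ereal (r + u \<bullet> (y - a)) \<le> \<phi> y"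
    using assms(1) by (rule subdifferentialD) auto
  obtain s where s: "\<phi> b = ereal s" "\<And>y. ereal (s + v \<bullet> (y - b)) \<le> \<phi> y"
    using assms(2) by (rule subdifferentialD) auto
  have "r + u \<bullet> (b - a) \<le> s" "s + v \<bullet> (a - b) \<le> r"
    using r(2)[of b] s(2)[of a] r(1) s(1) by auto
  then show ?thesis by (simp add: algebra_simps)
qed

section \<open>Attainment of minima of lower semicontinuous functions on compact sets\<close>

text \<open>\<open>Liminf (at a)\<close> ignores the point \<open>a\<close> itself; the strict
  inequality at \<open>a\<close> fills the hole, so it holds on a full neighbourhood.\<close>

lemma lsc_open_superlevel:
  fixes \<phi> :: "'a::topological_space \<Rightarrow> ereal"
  assumes "lsc_fun \<phi>"
  shows "open {a. c < \<phi> a}"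
proof (rule Topological_Spaces.openI)
  fix a assume "a \<in> {a. c < \<phi> a}"
  then have "c < \<phi> a" "c < Liminf (at a) \<phi>"
    using assms by (auto simp: lsc_fun_def intro: less_le_trans)
  then have "eventually (\<lambda>w. c < \<phi> w) (nhds a)"
    by (auto simp: eventually_nhds_conv_at dest: less_LiminfD)
  then show "\<exists>T. open T \<and> a \<in> T \<and> T \<subseteq> {a. c < \<phi> a}"
    by (auto simp: eventually_nhds)
qed

lemma lsc_open_superlevel_add_continuous:
  fixes \<phi> :: "'a::topological_space \<Rightarrow> ereal"
  assumes "lsc_fun \<phi>" and q: "continuous_on UNIV q" and fin: "\<And>x. \<phi> x \<noteq> -\<infinity>"
  shows "open {a. c < \<phi> a + ereal (q a)}"
proof (cases c)
  case (real r)
  \<comment> \<open>A real threshold \<open>e\<close> strictly between \<open>r - q a\<close> and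
    \<open>\<phi> a\<close> decouples the two functions and leaves a union of intersections of open
    sets.\<close>
  have "{a. c < \<phi> a + ereal (q a)} = (\<Union>e. {a. ereal e < \<phi> a} \<inter> {a. r - q a < e})"
  proof (intro set_eqI iffI)
    fix a assume "a \<in> {a. c < \<phi> a + ereal (q a)}"
    then have "ereal (r - q a) < \<phi> a"
      using real fin[of a] by (cases "\<phi> a") auto
    then obtain e where "ereal (r - q a) < ereal e" "ereal e < \<phi> a"
      using ereal_dense2 by blast
    then show "a \<in> (\<Union>e. {a. ereal e < \<phi> a} \<inter> {a. r - q a < e})" by auto
  next
    fix a assume "a \<in> (\<Union>e. {a. ereal e < \<phi> a} \<inter> {a. r - q a < e})"
    then obtain e where "ereal e < \<phi> a" "r - q a < e" by auto
    then show "a \<in> {a. c < \<phi> a + ereal (q a)}"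
      using real by (cases "\<phi> a") auto
  qed
  moreover have "open {a. r - q a < e}" for e
    by (intro open_Collect_less continuous_intros q)
  ultimately show ?thesis
    using lsc_open_superlevel[OF assms(1)] by (auto intro!: open_UN)
next
  case MInf
  have "- \<infinity> < \<phi> a + ereal (q a)" for a
    using fin[of a] by (cases "\<phi> a") auto
  with MInf show ?thesis by simp
qed simp

text \<open>Without a minimizer, the open sets \<open>{a. F b < F a}\<close> with \<open>b\<close>
  in \<open>K\<close> cover \<open>K\<close>; the lowest centre of a finite subcover is then left
  uncovered.\<close>

lemma compact_attains_min:
  fixes F :: "'a::topological_space \<Rightarrow> 'b::linorder"
  assumes "compact K" "K \<noteq> {}" and "\<And>c. open {a. c < F a}"
  shows "\<exists>z\<in>K. \<forall>w\<in>K. F z \<le> F w"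
proof (rule ccontr)
  assume "\<not> ?thesis"
  then have ex: "\<exists>w\<in>K. F w < F z" if "z \<in> K" for z
    using that by (force simp: not_le)
  define U where "U b = {a. F b < F a}" for b
  have "K \<subseteq> (\<Union>b\<in>K. U b)"
    using ex by (auto simp: U_def)
  then obtain C where C: "C \<subseteq> K" "finite C" "K \<subseteq> (\<Union>b\<in>C. U b)"
    using compactE_image[OF assms(1), of K U] assms(3) by (auto simp: U_def)
  then have "C \<noteq> {}" using assms(2) by auto
  then obtain b where b: "b \<in> C" "\<And>c. c \<in> C \<Longrightarrow> F b \<le> F c"
    using C(2) by (meson arg_min_if_finite(1) arg_min_least)
  then show False using C by (force simp: U_def)
qed

section \<open>The proximal point: existence, optimality condition, uniqueness\<close>

lemma norm_diff_sq_expand: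
  fixes a b x :: "'a::real_inner"
  shows "(norm (b - x))\<^sup>2 = (norm (a - x))\<^sup>2 + 2 * ((a - x) \<bullet> (b - a)) + (norm (b - a))\<^sup>2"
  by (simp add: power2_norm_eq_inner algebra_simps inner_commute)

lemma prox_minimizer_exists:
  fixes \<phi> :: "'a::euclidean_space \<Rightarrow> ereal"
  assumes prp: "proper_fun \<phi>" and lsc: "lsc_fun \<phi>" and t: "0 < t"
    and v: "v \<in> subdifferential \<phi> p"
  shows "\<exists>z. \<forall>w. \<phi> z + ereal (1 / (2 * t) * (norm (z - x))\<^sup>2)
                \<le> \<phi> w + ereal (1 / (2 * t) * (norm (w - x))\<^sup>2)"
proof -
  define F where "F w = \<phi> w + ereal (1 / (2 * t) * (norm (w - x))\<^sup>2)" for w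
  obtain r where r: "\<phi> p = ereal r" "\<And>y. ereal (r + v \<bullet> (y - p)) \<le> \<phi> y"
    using v by (rule subdifferentialD) auto
  \<comment> \<open>\<open>q\<close> is the slope at \<open>p\<close> of the affine minorant plus
    the quadratic. The objective at \<open>w\<close> exceeds its value at \<open>p\<close> by at
    least \<open>q \<bullet> (w - p) + (norm (w - p))^2 / (2 * t)\<close>, which is nonnegative
    outside the ball of radius \<open>R\<close>; minimizing over that ball suffices.\<close>
  define q where "q = v + (1 / t) *\<^sub>R (p - x)"
  define R where "R = 2 * t * norm q"
  have R0: "R \<ge> 0" using t by (simp add: R_def)
  have op: "open {a. c < F a}" for c
    unfolding F_def using prp
    by (intro lsc_open_superlevel_add_continuous lsc continuous_intros) (auto simp: proper_fun_def)
  obtain z where z: "z \<in> cball p R" "\<And>w. w \<in> cball p R \<Longrightarrow> F z \<le> F w"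
    using compact_attains_min[of "cball p R" F, OF _ _ op] R0 by auto
  have "F z \<le> F w" for w
  proof (cases "w \<in> cball p R")
    case False
    then have far: "norm (w - p) > 2 * t * norm q"
      by (simp add: R_def dist_norm norm_minus_commute)
    have "0 \<le> norm (w - p) * (norm (w - p) - 2 * t * norm q)"
      using far by (intro mult_nonneg_nonneg) auto
    then have "norm q * norm (w - p) \<le> (norm (w - p))\<^sup>2 / (2 * t)"
      using t by (simp add: field_simps power2_eq_square)
    moreover have "- (norm q * norm (w - p)) \<le> q \<bullet> (w - p)"
      using Cauchy_Schwarz_ineq2[of q "w - p"] by linarith
    ultimately have "0 \<le> q \<bullet> (w - p) + (norm (w - p))\<^sup>2 / (2 * t)" by linarith
    moreover have "1 / (2 * t) * (norm (w - x))\<^sup>2 = 1 / (2 * t) * (norm (p - x))\<^sup>2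
        + (1 / t) * ((p - x) \<bullet> (w - p)) + (norm (w - p))\<^sup>2 / (2 * t)"
      using t unfolding norm_diff_sq_expand[of w x p] by (simp add: field_simps)
    ultimately have "ereal (r + 1 / (2 * t) * (norm (p - x))\<^sup>2)
        \<le> ereal (r + v \<bullet> (w - p)) + ereal (1 / (2 * t) * (norm (w - x))\<^sup>2)"
      by (simp add: q_def inner_add_left)
    also have "\<dots> \<le> F w"
      unfolding F_def by (intro add_mono r) auto
    finally have "F p \<le> F w" by (simp add: F_def r)
    with z(2)[of p] R0 show ?thesis by auto
  qed (rule z(2))
  then show ?thesis unfolding F_def by blast
qed

text \<open>Compare \<open>z\<close> with the point a fraction \<open>l\<close> of the way to
  \<open>w\<close>: convexity bounds \<phi> linearly in \<open>l\<close>, and the quadratic changes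
  by a linear term plus one of order \<open>l^2\<close>. Dividing by \<open>l\<close> and letting it
  tend to 0 leaves the subgradient inequality.\<close>

lemma minimizer_subgradient:
  fixes \<phi> :: "'a::real_inner \<Rightarrow> ereal"
  assumes prp: "proper_fun \<phi>" and cvx: "convex_fun \<phi>" and t: "0 < t"
    and min: "\<And>w. \<phi> z + ereal (1 / (2 * t) * (norm (z - x))\<^sup>2)
                \<le> \<phi> w + ereal (1 / (2 * t) * (norm (w - x))\<^sup>2)"
  shows "(1 / t) *\<^sub>R (x - z) \<in> subdifferential \<phi> z"
proof -
  have ninf: "\<phi> w \<noteq> -\<infinity>" for w using prp by (auto simp: proper_fun_def)
  obtain w0 where "\<phi> w0 \<noteq> \<infinity>" using prp by (auto simp: proper_fun_def)
  then have "\<phi> z \<noteq> \<infinity>" using min[of w0] by auto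
  then obtain r where r: "\<phi> z = ereal r" using ninf[of z] by (cases "\<phi> z") auto
  show ?thesis
  proof (rule subdifferentialI[where r = r])
    show "\<phi> z = ereal r" by (rule r)
    fix w
    show "ereal (r + ((1 / t) *\<^sub>R (x - z)) \<bullet> (w - z)) \<le> \<phi> w"
    proof (cases "\<phi> w")
      case (real s)
      define D where "D = r + ((1 / t) *\<^sub>R (x - z)) \<bullet> (w - z) - s"
      have "D \<le> l * ((norm (w - z))\<^sup>2 / (2 * t))" if l: "0 < l" "l < 1" for l
      proof -
        define m where "m = (1 - l) *\<^sub>R z + l *\<^sub>R w"
        have "\<phi> m \<le> ereal (1 - l) * \<phi> z + ereal l * \<phi> w"
          using cvx l by (auto simp: convex_fun_def m_def)
        then have "\<phi> m \<le> ereal ((1 - l) * r + l * s)" by (simp add: r real)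
        then have "\<phi> m + ereal (1 / (2 * t) * (norm (m - x))\<^sup>2)
            \<le> ereal ((1 - l) * r + l * s) + ereal (1 / (2 * t) * (norm (m - x))\<^sup>2)"
          by (intro add_mono) auto
        with min[of m] have le: "r + 1 / (2 * t) * (norm (z - x))\<^sup>2
            \<le> (1 - l) * r + l * s + 1 / (2 * t) * (norm (m - x))\<^sup>2"
          by (auto simp: r dest: order_trans)
        have mz: "m - z = l *\<^sub>R (w - z)" by (simp add: m_def algebra_simps)
        have "(norm (m - x))\<^sup>2 = (norm (z - x))\<^sup>2 + 2 * l * ((z - x) \<bullet> (w - z)) + l\<^sup>2 * (norm (w - z))\<^sup>2"
          unfolding norm_diff_sq_expand[of m x z] mz by (simp add: power_mult_distrib)
        with le have "l * (r - s) \<le> 1 / (2 * t) * (2 * l * ((z - x) \<bullet> (w - z)) + l\<^sup>2 * (norm (w - z))\<^sup>2)"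
          by (simp add: algebra_simps)
        also have "\<dots> = l * ((1 / t) * ((z - x) \<bullet> (w - z)) + l * ((norm (w - z))\<^sup>2 / (2 * t)))"
          using t by (simp add: field_simps power2_eq_square)
        finally have "r - s \<le> (1 / t) * ((z - x) \<bullet> (w - z)) + l * ((norm (w - z))\<^sup>2 / (2 * t))"
          using l by simp
        moreover have "(z - x) \<bullet> (w - z) = - ((x - z) \<bullet> (w - z))"
          by (simp add: algebra_simps)
        ultimately show ?thesis by (simp add: D_def)
      qed
      then have "eventually (\<lambda>l. D \<le> l * ((norm (w - z))\<^sup>2 / (2 * t))) (at_right 0)"
        using eventually_at_right_real[of 0 1] by (auto elim!: eventually_mono)
      moreover have "((\<lambda>l. l * ((norm (w - z))\<^sup>2 / (2 * t))) \<longlongrightarrow> 0 * ((norm (w - z))\<^sup>2 / (2 * t))) (at_right 0)"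
        by (intro tendsto_intros)
      ultimately have "D \<le> 0 * ((norm (w - z))\<^sup>2 / (2 * t))"
        by (intro tendsto_lowerbound) auto
      then show ?thesis by (simp add: D_def real)
    qed (use ninf[of w] in auto)
  qed
qed

text \<open>\<open>prox\<close> selects a minimizer by choice, so uniqueness is the point. The
  subgradient cancels the cross term of the expanded square, which leaves quadratic growth around
  \<open>z\<close>.\<close>

lemma prox_eqI:
  fixes \<phi> :: "'a::real_inner \<Rightarrow> ereal"
  assumes t: "0 < t" and sub: "(1 / t) *\<^sub>R (x - z) \<in> subdifferential \<phi> z"
  shows "prox t \<phi> x = z"
proof -
  define F where "F w = \<phi> w + ereal (1 / (2 * t) * (norm (w - x))\<^sup>2)" for w
  obtain r where r: "\<phi> z = ereal r"
    "\<And>y. ereal (r + ((1 / t) *\<^sub>R (x - z)) \<bullet> (y - z)) \<le> \<phi> y"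
    using sub by (rule subdifferentialD) auto
  have low: "F z + ereal (1 / (2 * t) * (norm (w - z))\<^sup>2) \<le> F w" for w
  proof -
    have "((1 / t) *\<^sub>R (x - z)) \<bullet> (w - z) = - ((z - x) \<bullet> (w - z)) / t"
      by (simp add: inner_diff_left)
    then have "F z + ereal (1 / (2 * t) * (norm (w - z))\<^sup>2)
        = ereal (r + ((1 / t) *\<^sub>R (x - z)) \<bullet> (w - z)) + ereal (1 / (2 * t) * (norm (w - x))\<^sup>2)"
      using t unfolding F_def r(1) norm_diff_sq_expand[of w x z] by (simp add: field_simps)
    also have "\<dots> \<le> F w" unfolding F_def by (intro add_mono r) auto
    finally show ?thesis .
  qed
  have strict: "F z < F w" if "w \<noteq> z" for w
  proof -
    have "0 < 1 / (2 * t) * (norm (w - z))\<^sup>2" using that t by simp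
    then have "F z < F z + ereal (1 / (2 * t) * (norm (w - z))\<^sup>2)" by (simp add: F_def r)
    from this low[of w] show ?thesis by (rule less_le_trans)
  qed
  then have le: "F z \<le> F w" for w by (cases "w = z") (auto intro: less_imp_le)
  have "arg_min F (\<lambda>_. True) = z"
    unfolding arg_min_def
  proof (rule some_equality)
    show "is_arg_min F (\<lambda>_. True) z" using le by (simp add: is_arg_min_linorder)
    show "w = z" if "is_arg_min F (\<lambda>_. True) w" for w
      using that strict[of w] by (auto simp: is_arg_min_def)
  qed
  then show ?thesis
    by (simp add: prox_def F_def[abs_def])
qed

text \<open>A subgradient at a single point supplies the affine minorant behind existence;
  optimality and uniqueness then identify the minimizer with \<open>prox\<close>.\<close>

lemma prox_subgradient:
  fixes \<phi> :: "'a::euclidean_space \<Rightarrow> ereal"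
  assumes "proper_fun \<phi>" "lsc_fun \<phi>" "convex_fun \<phi>" "0 < t"
    and "v \<in> subdifferential \<phi> p"
  shows "(1 / t) *\<^sub>R (x - prox t \<phi> x) \<in> subdifferential \<phi> (prox t \<phi> x)"
proof -
  obtain z where z: "\<And>w. \<phi> z + ereal (1 / (2 * t) * (norm (z - x))\<^sup>2)
                \<le> \<phi> w + ereal (1 / (2 * t) * (norm (w - x))\<^sup>2)"
    using prox_minimizer_exists[OF assms(1,2,4,5)] by blast
  have "(1 / t) *\<^sub>R (x - z) \<in> subdifferential \<phi> z"
    by (intro minimizer_subgradient assms z)
  with prox_eqI[OF assms(4) this] show ?thesis by simp
qed

text \<open>Monotonicity gives firm nonexpansiveness,
  \<open>(a - b) \<bullet> (a - b) \<le> (x - x') \<bullet> (a - b)\<close>; Cauchy-Schwarz does the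
  rest.\<close>

lemma monotone_resolvent_nonexpansive:
  fixes a b x x' :: "'a::real_inner"
  assumes "0 < t" "((1 / t) *\<^sub>R (x - a) - (1 / t) *\<^sub>R (x' - b)) \<bullet> (a - b) \<ge> 0"
  shows "norm (a - b) \<le> norm (x - x')"
proof -
  have "(1 / t) * ((x - a - (x' - b)) \<bullet> (a - b)) \<ge> 0"
    using assms(2) by (simp flip: scaleR_right_diff_distrib)
  then have "0 \<le> (x - a - (x' - b)) \<bullet> (a - b)"
    using assms(1) by (simp add: zero_le_divide_iff)
  then have "(a - b) \<bullet> (a - b) \<le> (x - x') \<bullet> (a - b)"
    by (simp add: algebra_simps)
  also have "\<dots> \<le> norm (x - x') * norm (a - b)" by (rule norm_cauchy_schwarz)
  finally have "norm (a - b) * norm (a - b) \<le> norm (x - x') * norm (a - b)"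
    by (simp add: power2_norm_eq_inner[symmetric] power2_eq_square)
  then show ?thesis by (cases "a = b") auto
qed

subsection \<open>Smooth convex functions\<close>

lemma gderiv_along_line:
  assumes "\<And>x. GDERIV h x :> dh x"
  shows "((\<lambda>s. h (a + s *\<^sub>R d)) has_real_derivative dh (a + s *\<^sub>R d) \<bullet> d) (at s)"
proof -
  have "(h has_derivative (\<lambda>v. v \<bullet> dh (a + s *\<^sub>R d))) (at (a + s *\<^sub>R d))"
    using assms by (simp add: gderiv_def)
  then have "((\<lambda>s. h (a + s *\<^sub>R d)) has_derivative (\<lambda>v. (v *\<^sub>R d) \<bullet> dh (a + s *\<^sub>R d))) (at s)"
    by (rule has_derivative_compose[rotated]) (auto intro!: derivative_eq_intros)
  moreover have "(\<lambda>v. (v *\<^sub>R d) \<bullet> dh (a + s *\<^sub>R d)) = (*) (dh (a + s *\<^sub>R d) \<bullet> d)"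
    by (auto simp: fun_eq_iff inner_commute)
  ultimately show ?thesis by (simp add: has_field_derivative_def)
qed

lemma convex_gradient_inequality:
  fixes h :: "'a::real_inner \<Rightarrow> real"
  assumes cvx: "convex_on UNIV h" and grad: "\<And>x. GDERIV h x :> dh x"
  shows "h a + dh a \<bullet> (b - a) \<le> h b"
proof -
  define \<psi> where "\<psi> s = h (a + s *\<^sub>R (b - a))" for s
  have der: "(\<psi> has_real_derivative dh a \<bullet> (b - a)) (at 0)"
    using gderiv_along_line[OF grad, where a = a and d = "b - a" and s = 0] by (simp add: \<psi>_def[abs_def])
  have "convex_on UNIV \<psi>"
  proof (rule convex_onI)
    fix l x y :: real assume l: "0 < l" "l < 1"
    have "a + ((1 - l) *\<^sub>R x + l *\<^sub>R y) *\<^sub>R (b - a)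
        = (1 - l) *\<^sub>R (a + x *\<^sub>R (b - a)) + l *\<^sub>R (a + y *\<^sub>R (b - a))"
      by (simp add: algebra_simps)
    then show "\<psi> ((1 - l) *\<^sub>R x + l *\<^sub>R y) \<le> (1 - l) * \<psi> x + l * \<psi> y"
      unfolding \<psi>_def using convex_onD[OF cvx, of l] l by simp
  qed auto
  from convex_on_imp_above_tangent[OF this _ _ _ der, of 1]
  show ?thesis by (simp add: \<psi>_def)
qed

lemma descent_lemma:
  fixes h :: "'a::real_inner \<Rightarrow> real"
  assumes grad: "\<And>x. GDERIV h x :> dh x" and lip: "L-lipschitz_on UNIV dh"
  shows "h b \<le> h a + dh a \<bullet> (b - a) + L / 2 * (norm (b - a))\<^sup>2"
proof -
  define d where "d = b - a"
  \<comment> \<open>\<psi> is \<open>h\<close> along the segment less the first- and second-order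
    terms of the bound; the Lipschitz gradient makes its derivative nonpositive.\<close>
  define \<psi> where "\<psi> s = h (a + s *\<^sub>R d) - s * (dh a \<bullet> d) - L / 2 * s\<^sup>2 * (norm d)\<^sup>2" for s
  have "\<psi> 1 \<le> \<psi> 0"
  proof (rule DERIV_nonpos_imp_nonincreasing[where f = \<psi> and a = 0 and b = 1])
    fix s :: real assume s: "0 \<le> s" "s \<le> 1"
    have "(\<psi> has_real_derivative dh (a + s *\<^sub>R d) \<bullet> d - dh a \<bullet> d - L * s * (norm d)\<^sup>2) (at s)"
      unfolding \<psi>_def[abs_def]
      by (auto intro!: derivative_eq_intros gderiv_along_line grad)
    moreover have "(dh (a + s *\<^sub>R d) - dh a) \<bullet> d \<le> L * s * (norm d)\<^sup>2"
    proof -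
      have "(dh (a + s *\<^sub>R d) - dh a) \<bullet> d \<le> norm (dh (a + s *\<^sub>R d) - dh a) * norm d"
        by (rule norm_cauchy_schwarz)
      also have "\<dots> \<le> (L * norm (s *\<^sub>R d)) * norm d"
        using lipschitz_onD[OF lip, of "a + s *\<^sub>R d" a]
        by (intro mult_right_mono) (auto simp: dist_norm)
      finally show ?thesis using s by (simp add: power2_eq_square)
    qed
    ultimately show "\<exists>y. DERIV \<psi> s :> y \<and> y \<le> 0"
      by (auto simp: inner_diff_left)
  qed simp
  then show ?thesis by (simp add: \<psi>_def d_def)
qed

text \<open>Compare the tangent at \<open>a\<close> with the quadratic upper bound at \<open>b\<close>, both evaluated at the
  gradient step \<open>b - (1/L) (dh b - dh a)\<close>.\<close>

lemma cocoercive_half: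
  fixes h :: "'a::real_inner \<Rightarrow> real"
  assumes cvx: "convex_on UNIV h" and grad: "\<And>x. GDERIV h x :> dh x"
    and lip: "L-lipschitz_on UNIV dh" and L: "0 < L"
  shows "h a + dh a \<bullet> (b - a) + (norm (dh b - dh a))\<^sup>2 / (2 * L) \<le> h b"
proof -
  define e where "e = dh b - dh a"
  define c where "c = b - (1 / L) *\<^sub>R e"
  have "h a + dh a \<bullet> (c - a) \<le> h c"
    by (rule convex_gradient_inequality[OF cvx grad])
  moreover have "h c \<le> h b + dh b \<bullet> (c - b) + L / 2 * (norm (c - b))\<^sup>2"
    by (rule descent_lemma[OF grad lip])
  moreover have "L / 2 * (norm (c - b))\<^sup>2 = (e \<bullet> e) / (2 * L)"
    using L by (simp add: c_def power_mult_distrib power2_norm_eq_inner[symmetric] field_simps)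
      (simp add: power2_eq_square)
  moreover have "dh a \<bullet> (c - a) - dh b \<bullet> (c - b) = dh a \<bullet> (b - a) + (e \<bullet> e) / L"
  proof -
    have "dh a \<bullet> (c - a) - dh b \<bullet> (c - b) = dh a \<bullet> (b - a) - e \<bullet> (c - b)"
      by (simp add: e_def algebra_simps)
    then show ?thesis by (simp add: c_def)
  qed
  moreover have "(e \<bullet> e) / L = 2 * ((e \<bullet> e) / (2 * L))" using L by simp
  ultimately show ?thesis
    unfolding e_def[symmetric] power2_norm_eq_inner by linarith
qed

text \<open>Sum of \<open>cocoercive_half\<close> and its copy with \<open>a\<close> and
  \<open>b\<close> exchanged.\<close>

lemma baillon_haddad:
  fixes h :: "'a::real_inner \<Rightarrow> real"
  assumes "convex_on UNIV h" "\<And>x. GDERIV h x :> dh x" "L-lipschitz_on UNIV dh" "0 < L"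
  shows "(norm (dh a - dh b))\<^sup>2 / L \<le> (dh a - dh b) \<bullet> (a - b)"
proof -
  have "(norm (dh a - dh b))\<^sup>2 / L = 2 * ((norm (dh a - dh b))\<^sup>2 / (2 * L))" by simp
  moreover have "(dh a - dh b) \<bullet> (a - b) = - (dh a \<bullet> (b - a)) - dh b \<bullet> (a - b)"
    by (simp add: algebra_simps)
  ultimately show ?thesis
    using cocoercive_half[OF assms, of a b] cocoercive_half[OF assms, of b a]
    by (simp add: norm_minus_commute)
qed

subsection \<open>Averaged operators with summable errors\<close>

text \<open>\<open>Y\<close>, \<open>Z\<close>, \<open>U\<close>, \<open>H\<close> stand for the
  differences, between two inputs, of y, z, x - y and the gradient at y. Thus \<open>Y + U\<close>
  is the difference of the inputs and \<open>Z + U\<close> that of the outputs.\<close>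

lemma davis_yin_inequality:
  fixes Y Z U H :: "'a::real_inner"
  assumes "0 < L" "0 < t" and fmon: "U \<bullet> Y \<ge> 0" and gmon: "(Y - U - t *\<^sub>R H - Z) \<bullet> Z \<ge> 0"
    and coco: "(norm H)\<^sup>2 / L \<le> H \<bullet> Y"
  shows "(norm (Z + U))\<^sup>2 + (1 - t * L / 2) * (norm (Y - Z))\<^sup>2 \<le> (norm (Y + U))\<^sup>2"
proof -
  \<comment> \<open>The slack is an exact identity. The shift \<open>L / 2\<close> in the last
    square cancels the cross term \<open>2 * t * (H \<bullet> (Y - Z))\<close> and leaves
    \<open>t * L / 2\<close> times the square of \<open>norm (Y - Z)\<close>.\<close>
  have "(norm (Y + U))\<^sup>2 - (norm (Z + U))\<^sup>2 - (1 - t * L / 2) * (norm (Y - Z))\<^sup>2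
      = 2 * (U \<bullet> Y) + 2 * ((Y - U - t *\<^sub>R H - Z) \<bullet> Z)
        + 2 * t * (H \<bullet> Y - (norm H)\<^sup>2 / L)
        + 2 * t / L * (norm (H - (L / 2) *\<^sub>R (Y - Z)))\<^sup>2"
    using assms(1) unfolding power2_norm_eq_inner
    by (simp add: inner_commute inner_simps field_simps)
  also have "\<dots> \<ge> 0"
    using assms by (intro add_nonneg_nonneg mult_nonneg_nonneg) auto
  finally show ?thesis by simp
qed

section \<open>Convergence under summable perturbations\<close>

text \<open>Subtracting the partial sums of the errors gives a decreasing sequence that is bounded
  below.\<close>

lemma quasi_monotone_convergent:
  fixes a \<epsilon> :: "nat \<Rightarrow> real"
  assumes a: "\<And>k. 0 \<le> a k" and step: "\<And>k. a (Suc k) \<le> a k + \<epsilon> k"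
    and \<epsilon>: "summable \<epsilon>"
  shows "convergent a"
proof -
  define b where "b k = a k - sum \<epsilon> {..<k}" for k
  have conv: "convergent (\<lambda>k. sum \<epsilon> {..<k})"
    using \<epsilon> by (simp add: summable_iff_convergent)
  then obtain B where B: "\<And>k. sum \<epsilon> {..<k} \<le> B"
    using convergent_imp_Bseq Bseq_def by (metis abs_le_D1 real_norm_def)
  have "decseq b"
    using step by (intro decseq_SucI) (auto simp: b_def algebra_simps)
  moreover have "- B \<le> b k" for k using a[of k] B[of k] by (simp add: b_def)
  ultimately have "convergent b" using decseq_convergent convergentI by metis
  from convergent_add[OF this conv] show ?thesis by (simp add: b_def)
qed

lemma krasnoselskii_mann_inexact:
  fixes T :: "'a::euclidean_space \<Rightarrow> 'a" and x :: "nat \<Rightarrow> 'a"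
  assumes c: "0 < c"
    and av: "\<And>a b. (norm (T a - T b))\<^sup>2 + c * (norm ((a - T a) - (b - T b)))\<^sup>2 \<le> (norm (a - b))\<^sup>2"
    and q: "T q = q"
    and err: "\<And>k. norm (x (Suc k) - T (x k)) \<le> \<epsilon> k" and \<epsilon>: "summable \<epsilon>"
  shows "\<exists>x'. T x' = x' \<and> x \<longlonglongrightarrow> x'"
proof -
  have nonexp: "norm (T a - T b) \<le> norm (a - b)" for a b
  proof -
    have "0 \<le> c * (norm ((a - T a) - (b - T b)))\<^sup>2" using c by simp
    with av[of a b] have "(norm (T a - T b))\<^sup>2 \<le> (norm (a - b))\<^sup>2" by linarith
    then show ?thesis by (rule power2_le_imp_le) simp
  qed
  have fejer: "norm (x (Suc k) - s) \<le> norm (T (x k) - s) + \<epsilon> k" for s k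
    using norm_triangle_ineq[of "x (Suc k) - T (x k)" "T (x k) - s"] err[of k] by simp
  have conv: "convergent (\<lambda>k. norm (x k - s))" if "T s = s" for s
  proof (rule quasi_monotone_convergent[OF _ _ \<epsilon>])
    show "norm (x (Suc k) - s) \<le> norm (x k - s) + \<epsilon> k" for k
      using fejer[of k s] nonexp[of "x k" s] that by simp
  qed simp
  obtain l where l: "(\<lambda>k. norm (x k - q)) \<longlonglongrightarrow> l"
    using conv[OF q] by (auto simp: convergent_def)
  \<comment> \<open>The distance from \<open>T (x k)\<close> to \<open>q\<close> is squeezed between
    this sequence and \<open>norm (x k - q)\<close>. Having the same limit before and after applying
    \<open>T\<close> forces, through \<open>av\<close>, the residuals \<open>x k - T (x k)\<close>
    to 0.\<close>
  have low: "(\<lambda>k. norm (x (Suc k) - q) - \<epsilon> k) \<longlonglongrightarrow> l"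
    using tendsto_diff[OF LIMSEQ_Suc[OF l] summable_LIMSEQ_zero[OF \<epsilon>]] by simp
  have "norm (x (Suc k) - q) - \<epsilon> k \<le> norm (T (x k) - q)" "norm (T (x k) - q) \<le> norm (x k - q)" for k
    using fejer[of k q] nonexp[of "x k" q] q by simp_all
  then have Tl: "(\<lambda>k. norm (T (x k) - q)) \<longlonglongrightarrow> l"
    by (intro tendsto_sandwich[OF _ _ low l] always_eventually) auto
  have lim0: "(\<lambda>k. ((norm (x k - q))\<^sup>2 - (norm (T (x k) - q))\<^sup>2) / c) \<longlonglongrightarrow> (l\<^sup>2 - l\<^sup>2) / c"
    using c by (intro tendsto_intros l Tl) auto
  have "(\<lambda>k. (norm (x k - T (x k)))\<^sup>2) \<longlonglongrightarrow> 0"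
  proof (rule tendsto_sandwich[OF _ _ tendsto_const])
    show "eventually (\<lambda>k. (norm (x k - T (x k)))\<^sup>2 \<le> ((norm (x k - q))\<^sup>2 - (norm (T (x k) - q))\<^sup>2) / c) sequentially"
      using av[of _ q, unfolded q] c by (intro always_eventually) (simp add: field_simps)
  qed (use lim0 in auto)
  then have "(\<lambda>k. sqrt ((norm (x k - T (x k)))\<^sup>2)) \<longlonglongrightarrow> sqrt 0" by (rule tendsto_real_sqrt)
  then have reg: "(\<lambda>k. x k - T (x k)) \<longlonglongrightarrow> 0" by (simp add: tendsto_norm_zero_iff)
  have "bounded (range x)"
  proof -
    obtain B where "\<And>k. norm (norm (x k - q)) \<le> B"
      using conv[OF q] convergent_imp_Bseq Bseq_def by metis
    then have "range x \<subseteq> cball q B" by (auto simp: dist_norm norm_minus_commute)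
    then show ?thesis using bounded_cball bounded_subset by blast
  qed
  then obtain x' r where r: "strict_mono r" "(x \<circ> r) \<longlonglongrightarrow> x'"
    using bounded_imp_convergent_subsequence by blast
  have "continuous_on UNIV T"
    using nonexp by (intro lipschitz_on_continuous_on[of 1] lipschitz_onI) (auto simp: dist_norm)
  then have "(\<lambda>k. T ((x \<circ> r) k)) \<longlonglongrightarrow> T x'"
    by (rule continuous_on_tendsto_compose[OF _ r(2)]) auto
  then have "(\<lambda>k. (x \<circ> r) k - T ((x \<circ> r) k)) \<longlonglongrightarrow> x' - T x'"
    by (intro tendsto_diff r)
  moreover have "(\<lambda>k. (x \<circ> r) k - T ((x \<circ> r) k)) \<longlonglongrightarrow> 0"
    using LIMSEQ_subseq_LIMSEQ[OF reg r(1)] by (simp add: o_def)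
  ultimately have fixd: "T x' = x'"
    using LIMSEQ_unique by fastforce
  \<comment> \<open>The distance to the cluster point \<open>x'\<close> converges because
    \<open>x'\<close> is a fixed point, and it tends to 0 along the subsequence; hence the whole
    sequence converges.\<close>
  obtain m where m: "(\<lambda>k. norm (x k - x')) \<longlonglongrightarrow> m"
    using conv[OF fixd] by (auto simp: convergent_def)
  have "(\<lambda>k. norm ((x \<circ> r) k - x')) \<longlonglongrightarrow> norm (x' - x')"
    by (intro tendsto_intros r)
  moreover have "(\<lambda>k. norm ((x \<circ> r) k - x')) \<longlonglongrightarrow> m"
    using LIMSEQ_subseq_LIMSEQ[OF m r(1)] by (simp add: o_def)
  ultimately have "m = 0" using LIMSEQ_unique by fastforce
  with m have "(\<lambda>k. x k - x') \<longlonglongrightarrow> 0" by (simp add: tendsto_norm_zero_iff)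
  then have "x \<longlonglongrightarrow> x'" by (simp add: LIM_zero_iff)
  with fixd show ?thesis by blast
qed

subsection \<open>Distance between the HJ-Prox and the proximal point\<close>

lemma nn_integral_lborel_affine:
  fixes f :: "'a::euclidean_space \<Rightarrow> ennreal"
  assumes [measurable]: "f \<in> borel_measurable borel" and c: "c \<noteq> 0"
  shows "(\<integral>\<^sup>+y. f y \<partial>lborel) = ennreal (\<bar>c\<bar> ^ DIM('a)) * (\<integral>\<^sup>+y. f (a + c *\<^sub>R y) \<partial>lborel)"
  by (subst lborel_affine[OF c, of a])
    (simp add: nn_integral_density nn_integral_distr nn_integral_cmult)

text \<open>\<open>contr\<close> bounds \<open>w y * (norm (y - p))^2\<close> by \<open>K\<close>
  times the weight at the midpoint. The map to the midpoint halves every coordinate about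
  \<open>p\<close>, so the integral of the midpoint weight is \<open>2 ^ DIM('a)\<close> times that
  of \<open>w\<close>.\<close>

lemma concentration_of_contraction_bound:
  fixes w :: "'a::euclidean_space \<Rightarrow> real" and p :: 'a
  assumes int: "integrable lborel w" and nn: "\<And>y. 0 \<le> w y" and K: "0 < K"
    and contr: "\<And>y. w y * (1 + (norm (y - p))\<^sup>2 / K) \<le> w ((1 / 2) *\<^sub>R p + (1 / 2) *\<^sub>R y)"
  shows "integrable lborel (\<lambda>y. w y * (norm (y - p))\<^sup>2)"
    and "(\<integral>y. w y * (norm (y - p))\<^sup>2 \<partial>lborel) \<le> K * 2 ^ DIM('a) * (\<integral>y. w y \<partial>lborel)"
proof -
  have [measurable]: "w \<in> borel_measurable borel" using int by auto
  define Z where "Z = (\<integral>y. w y \<partial>lborel)"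
  have Z: "(\<integral>\<^sup>+y. w y \<partial>lborel) = ennreal Z" "0 \<le> Z"
    using nn_integral_eq_integral[OF int] nn by (auto simp: Z_def)
  have "ennreal Z = ennreal ((1 / 2) ^ DIM('a)) * (\<integral>\<^sup>+y. w ((1 / 2) *\<^sub>R p + (1 / 2) *\<^sub>R y) \<partial>lborel)"
    using nn_integral_lborel_affine[of "\<lambda>y. ennreal (w y)" "1 / 2" "(1 / 2) *\<^sub>R p"] Z
    by simp
  then have "ennreal (2 ^ DIM('a)) * ennreal Z
      = ennreal (2 ^ DIM('a)) * ennreal ((1 / 2) ^ DIM('a)) * (\<integral>\<^sup>+y. w ((1 / 2) *\<^sub>R p + (1 / 2) *\<^sub>R y) \<partial>lborel)"
    by (simp add: mult.assoc)
  then have scal: "(\<integral>\<^sup>+y. w ((1 / 2) *\<^sub>R p + (1 / 2) *\<^sub>R y) \<partial>lborel) = ennreal (2 ^ DIM('a) * Z)"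
    using Z(2) by (simp add: ennreal_mult'[symmetric] power_mult_distrib[symmetric])
  have "(\<integral>\<^sup>+y. ennreal (w y * (norm (y - p))\<^sup>2) \<partial>lborel)
      \<le> (\<integral>\<^sup>+y. ennreal K * ennreal (w ((1 / 2) *\<^sub>R p + (1 / 2) *\<^sub>R y)) \<partial>lborel)"
  proof (rule nn_integral_mono)
    fix y
    have "w y * (norm (y - p))\<^sup>2 / K \<le> w ((1 / 2) *\<^sub>R p + (1 / 2) *\<^sub>R y)"
      using contr[of y] nn[of y] by (simp add: distrib_left)
    then have "w y * (norm (y - p))\<^sup>2 \<le> K * w ((1 / 2) *\<^sub>R p + (1 / 2) *\<^sub>R y)"
      using K by (simp add: field_simps)
    then show "ennreal (w y * (norm (y - p))\<^sup>2) \<le> ennreal K * ennreal (w ((1 / 2) *\<^sub>R p + (1 / 2) *\<^sub>R y))"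
      using K by (simp add: ennreal_mult'[symmetric] ennreal_leI)
  qed
  also have "\<dots> = ennreal (K * 2 ^ DIM('a) * Z)"
    using K Z(2) by (subst nn_integral_cmult) (simp_all add: scal ennreal_mult'[symmetric] mult.assoc)
  finally have le: "(\<integral>\<^sup>+y. ennreal (w y * (norm (y - p))\<^sup>2) \<partial>lborel) \<le> ennreal (K * 2 ^ DIM('a) * Z)" .
  \<comment> \<open>The finite bound on the nonnegative integral yields integrability, which is what
    allows passing to the Bochner integral.\<close>
  show int2: "integrable lborel (\<lambda>y. w y * (norm (y - p))\<^sup>2)"
    using le nn by (intro integrableI_nonneg) (auto simp: le_less_trans[OF _ ennreal_less_top])
  have "ennreal (\<integral>y. w y * (norm (y - p))\<^sup>2 \<partial>lborel) \<le> ennreal (K * 2 ^ DIM('a) * Z)"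
    using le nn_integral_eq_integral[OF int2] nn by simp
  then show "(\<integral>y. w y * (norm (y - p))\<^sup>2 \<partial>lborel) \<le> K * 2 ^ DIM('a) * (\<integral>y. w y \<partial>lborel)"
    using K Z(2) by (simp add: ennreal_le_iff Z_def)
qed

lemma norm_weighted_mean_diff_le:
  fixes w :: "'a::euclidean_space \<Rightarrow> real" and p :: 'a
  assumes int: "integrable M w" and sets: "sets M = sets borel"
    and nn: "\<And>y. 0 \<le> w y" and pos: "0 < (\<integral>y. w y \<partial>M)"
    and int2: "integrable M (\<lambda>y. w y * (norm (y - p))\<^sup>2)"
    and var: "(\<integral>y. w y * (norm (y - p))\<^sup>2 \<partial>M) \<le> s\<^sup>2 * (\<integral>y. w y \<partial>M)" and s: "0 < s"
  shows "norm ((\<integral>y. w y *\<^sub>R y \<partial>M) /\<^sub>R (\<integral>y. w y \<partial>M) - p) \<le> s"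
proof -
  note [measurable_cong] = sets
  have [measurable]: "w \<in> borel_measurable M" using int by auto
  have id [measurable]: "(\<lambda>y. y) \<in> borel_measurable M"
    using sets by (simp add: measurable_cong_sets[OF sets refl])
  define Z where "Z = (\<integral>y. w y \<partial>M)"
  \<comment> \<open>Linearizing the norm by the inequality of means replaces Jensen: both halves
    integrate to at most \<open>s / 2\<close> times the total weight, and the right side dominates
    the first moment.\<close>
  have bnd: "norm (y - p) \<le> s / 2 + (norm (y - p))\<^sup>2 / (2 * s)" for y
  proof -
    have "0 \<le> (norm (y - p) - s)\<^sup>2" by simp
    then have "2 * s * norm (y - p) \<le> s\<^sup>2 + (norm (y - p))\<^sup>2" by (simp add: power2_diff algebra_simps)
    then show ?thesis using s by (simp add: field_simps power2_eq_square)
  qed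
  define b where "b y = (s / 2) * w y + (w y * (norm (y - p))\<^sup>2) / (2 * s)" for y
  have intb: "integrable M b" unfolding b_def using int int2 by simp
  have le: "norm (w y *\<^sub>R (y - p)) \<le> b y" for y
    using mult_left_mono[OF bnd[of y] nn[of y]] nn[of y] by (simp add: b_def distrib_left mult_ac)
  have int1: "integrable M (\<lambda>y. w y *\<^sub>R (y - p))"
    by (rule Bochner_Integration.integrable_bound[OF intb])
      (use order_trans[OF le abs_ge_self] in auto)
  have "integrable M (\<lambda>y. w y *\<^sub>R (y - p) + w y *\<^sub>R p)"
    using int1 int by simp
  moreover have "(\<integral>y. w y *\<^sub>R (y - p) + w y *\<^sub>R p \<partial>M) = (\<integral>y. w y *\<^sub>R (y - p) \<partial>M) + Z *\<^sub>R p"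
    using int1 int by (simp add: Z_def)
  ultimately have "(\<integral>y. w y *\<^sub>R y \<partial>M) = (\<integral>y. w y *\<^sub>R (y - p) \<partial>M) + Z *\<^sub>R p"
    by (simp add: scaleR_diff_right)
  then have eq: "(\<integral>y. w y *\<^sub>R y \<partial>M) /\<^sub>R Z - p = (\<integral>y. w y *\<^sub>R (y - p) \<partial>M) /\<^sub>R Z"
    using pos by (simp add: Z_def scaleR_add_right)
  have "norm (\<integral>y. w y *\<^sub>R (y - p) \<partial>M) \<le> (\<integral>y. norm (w y *\<^sub>R (y - p)) \<partial>M)"
    by (rule integral_norm_bound)
  also have "\<dots> \<le> (\<integral>y. b y \<partial>M)"
    by (intro integral_mono intb integrable_norm int1 le)
  also have "\<dots> = (s / 2) * Z + (\<integral>y. w y * (norm (y - p))\<^sup>2 \<partial>M) / (2 * s)"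
    unfolding b_def using int int2 by (simp add: Z_def)
  also have "\<dots> \<le> (s / 2) * Z + (s\<^sup>2 * Z) / (2 * s)"
    using var s by (intro add_left_mono divide_right_mono) (auto simp: Z_def)
  also have "\<dots> = s * Z" using s by (simp add: power2_eq_square)
  finally show ?thesis
    using pos unfolding Z_def[symmetric] eq by (simp add: field_simps)
qed

text \<open>Strong convexity of \<open>\<phi> + \<parallel>\<cdot> - x\<parallel>\<^sup>2 / (2t)\<close> makes the density at the midpoint of \<open>p\<close>
  and \<open>y\<close> exceed that at \<open>y\<close> by the factor \<open>exp (\<parallel>y - p\<parallel>\<^sup>2 / (8\<delta>t))\<close>; only
  \<open>1 + r \<le> exp r\<close> is kept.\<close>

lemma hj_weight_midpoint:
  fixes \<phi> :: "'a::real_inner \<Rightarrow> ereal"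
  assumes prp: "proper_fun \<phi>" and cvx: "convex_fun \<phi>" and t: "0 < t" and \<delta>: "0 < \<delta>"
    and sub: "(1 / t) *\<^sub>R (x - p) \<in> subdifferential \<phi> p"
  defines "w \<equiv> \<lambda>y. exp (- (norm (y - x))\<^sup>2 / (2 * (\<delta> * t))) * hj_weight \<delta> \<phi> y"
  shows "w y * (1 + (norm (y - p))\<^sup>2 / (8 * t * \<delta>)) \<le> w ((1 / 2) *\<^sub>R p + (1 / 2) *\<^sub>R y)"
proof (cases "\<phi> y")
  case (real r)
  define m where "m = (1 / 2) *\<^sub>R p + (1 / 2) *\<^sub>R y"
  obtain s where s: "\<phi> p = ereal s"
    "\<And>y. ereal (s + ((1 / t) *\<^sub>R (x - p)) \<bullet> (y - p)) \<le> \<phi> y"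
    using sub by (rule subdifferentialD) auto
  have "\<phi> m \<le> ereal (1 / 2) * \<phi> p + ereal (1 / 2) * \<phi> y"
    using cvx unfolding convex_fun_def m_def by (elim allE[of _ p] allE[of _ y] allE[of _ "1/2"]) auto
  then have "\<phi> m \<le> ereal ((s + r) / 2)" by (simp add: s(1) real add_divide_distrib)
  moreover have "\<phi> m \<noteq> -\<infinity>" using prp by (auto simp: proper_fun_def)
  ultimately obtain q where q: "\<phi> m = ereal q" "q \<le> (s + r) / 2" by (cases "\<phi> m") auto
  have sr: "s + (x - p) \<bullet> (y - p) / t \<le> r" using s(2)[of y] real by simp
  define A B where "A = (x - p) \<bullet> (y - p)" and "B = (norm (y - p))\<^sup>2"
  have minus: "(p - x) \<bullet> (y - p) = - A" unfolding A_def by (simp add: algebra_simps)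
  have ny: "(norm (y - x))\<^sup>2 = (norm (p - x))\<^sup>2 - 2 * A + B"
    unfolding norm_diff_sq_expand[of y x p] minus B_def by simp
  have mp: "m - p = (1 / 2) *\<^sub>R (y - p)" by (simp add: m_def algebra_simps flip: scaleR_add_left)
  have nm: "(norm (m - x))\<^sup>2 = (norm (p - x))\<^sup>2 - A + B / 4"
    unfolding norm_diff_sq_expand[of m x p] mp by (simp add: minus B_def power_divide)
  define E where "E = B / (8 * t * \<delta>)"
  \<comment> \<open>With F the sum of \<phi> and the quadratic, strong convexity puts F at the
    midpoint at least \<open>B / (8 * t)\<close> below the average of F at \<open>p\<close> and at
    \<open>y\<close>, and F at \<open>p\<close> is at most F at \<open>y\<close>. The further gain
    \<open>B / (4 * t)\<close> is discarded as \<beta>.\<close>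
  have "(norm (m - x))\<^sup>2 / (2 * t) + q + B / (8 * t) \<le> (norm (y - x))\<^sup>2 / (2 * t) + r"
  proof -
    define i where "i = 1 / t"
    have "q * 2 \<le> s + r" using q(2) by simp
    then have lin: "M + q + b \<le> N + r"
      if "M + b = N + \<alpha> / 2 - \<beta> / 4" "0 \<le> \<beta>" "s + \<alpha> \<le> r" for M N b \<alpha> \<beta>
      using that by linarith
    have i: "a / (c * t) = (a * i) / c" for a c by (simp add: i_def)
    have "(norm (m - x))\<^sup>2 / (2 * t) + B / (8 * t)
        = (norm (y - x))\<^sup>2 / (2 * t) + (A * i) / 2 - (B * i) / 4"
      unfolding nm ny i by (simp add: field_simps)
    moreover have "0 \<le> B * i" using t by (simp add: B_def i_def)
    moreover have "s + A * i \<le> r" using sr by (simp add: A_def i_def)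
    ultimately show ?thesis by (rule lin)
  qed
  then have "((norm (m - x))\<^sup>2 / (2 * t) + q + B / (8 * t)) / \<delta> \<le> ((norm (y - x))\<^sup>2 / (2 * t) + r) / \<delta>"
    using \<delta> by (intro divide_right_mono) auto
  then have ex: "- (norm (y - x))\<^sup>2 / (2 * (\<delta> * t)) + - r / \<delta> + E
      \<le> - (norm (m - x))\<^sup>2 / (2 * (\<delta> * t)) + - q / \<delta>"
    by (simp add: E_def add_divide_distrib mult_ac)
  have "w y * (1 + E) \<le> w y * exp E"
    by (intro mult_left_mono exp_ge_add_one_self) (auto simp: w_def hj_weight_def)
  also have "\<dots> = exp (- (norm (y - x))\<^sup>2 / (2 * (\<delta> * t)) + - r / \<delta> + E)"
    by (simp add: w_def hj_weight_def real mult_exp_exp)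
  also have "\<dots> \<le> exp (- (norm (m - x))\<^sup>2 / (2 * (\<delta> * t)) + - q / \<delta>)"
    using ex by simp
  also have "\<dots> = w m" by (simp add: w_def hj_weight_def q mult_exp_exp)
  finally show ?thesis by (simp add: m_def E_def B_def)
\<comment> \<open>Where \<phi> is infinite the weight at \<open>y\<close>, hence the left side, is
  0.\<close>
qed (use prp in \<open>auto simp: w_def hj_weight_def proper_fun_def\<close>)

lemma hj_prox_error:
  fixes \<phi> :: "'a::euclidean_space \<Rightarrow> ereal"
  assumes prp: "proper_fun \<phi>" and cvx: "convex_fun \<phi>" and t: "0 < t" and \<delta>: "0 < \<delta>"
    and sub: "(1 / t) *\<^sub>R (x - p) \<in> subdifferential \<phi> p"
    and den: "hj_denominator \<delta> t \<phi> x \<noteq> 0"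
  shows "norm (hj_prox \<delta> t \<phi> x - p) \<le> sqrt (8 * t * 2 ^ DIM('a)) * sqrt \<delta>"
proof -
  define \<kappa> where "\<kappa> = (2 * pi * (\<delta> * t)) powr (- real DIM('a) / 2)"
  have \<kappa>: "\<kappa> > 0" using t \<delta> by (simp add: \<kappa>_def)
  define k where "k y = \<kappa> * exp (- (norm (y - x))\<^sup>2 / (2 * (\<delta> * t)))" for y
  have k0: "k y \<ge> 0" for y using \<kappa> by (simp add: k_def)
  have [measurable]: "k \<in> borel_measurable borel" unfolding k_def by measurable
  have gau: "gaussian x (\<delta> * t) = density lborel (\<lambda>y. ennreal (k y))"
    by (simp add: gaussian_def k_def \<kappa>_def)
  \<comment> \<open>A Bochner integral of a non-integrable function is 0, so the nonzero denominator
    yields integrability and measurability of the weight, and below also positivity of its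
    mass.\<close>
  have "integrable (gaussian x (\<delta> * t)) (hj_weight \<delta> \<phi>)"
    using den not_integrable_integral_eq unfolding hj_denominator_def by blast
  moreover from this have meas [measurable]: "hj_weight \<delta> \<phi> \<in> borel_measurable borel"
    unfolding gau using borel_measurable_integrable by fastforce
  define w where "w y = k y * hj_weight \<delta> \<phi> y" for y
  ultimately have int: "integrable lborel w"
    unfolding gau w_def using k0 by (simp add: integrable_density)
  have D: "hj_denominator \<delta> t \<phi> x = (\<integral>y. w y \<partial>lborel)"
    unfolding hj_denominator_def gau w_def using k0 by (subst integral_density) auto
  have N: "hj_numerator \<delta> t \<phi> x = (\<integral>y. w y *\<^sub>R y \<partial>lborel)"
    unfolding hj_numerator_def gau w_def using k0 by (subst integral_density) auto
  have w0: "0 \<le> w y" for y using k0 by (simp add: w_def hj_weight_def)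
  then have pos: "0 < (\<integral>y. w y \<partial>lborel)"
    using den unfolding D by (simp add: order_less_le)
  have contr: "w y * (1 + (norm (y - p))\<^sup>2 / (8 * t * \<delta>)) \<le> w ((1 / 2) *\<^sub>R p + (1 / 2) *\<^sub>R y)" for y
    using mult_left_mono[OF hj_weight_midpoint[OF prp cvx t \<delta> sub, of y], of \<kappa>] \<kappa>
    by (simp add: w_def k_def mult.assoc)
  have K: "0 < 8 * t * \<delta>" using t \<delta> by simp
  note conc = concentration_of_contraction_bound[OF int w0 K contr]
  \<comment> \<open>\<open>s^2\<close> is the bound on the normalized second moment:
    \<open>K = 8 * t * \<delta>\<close> times the Jacobian factor
    \<open>2 ^ DIM('a)\<close>.\<close>
  define s where "s = sqrt (8 * t * 2 ^ DIM('a)) * sqrt \<delta>"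
  have s2: "s\<^sup>2 = 8 * t * \<delta> * 2 ^ DIM('a)"
    using t \<delta> by (simp add: s_def power_mult_distrib)
  have "norm ((\<integral>y. w y *\<^sub>R y \<partial>lborel) /\<^sub>R (\<integral>y. w y \<partial>lborel) - p) \<le> s"
    using conc(2) t \<delta> s2
    by (intro norm_weighted_mean_diff_le int w0 pos conc(1)) (auto simp: s_def)
  then show ?thesis by (simp add: hj_prox_def D N s_def)
qed

subsection \<open>The Davis--Yin operator\<close>

definition davis_yin :: "real \<Rightarrow> ('a::real_normed_vector \<Rightarrow> ereal) \<Rightarrow> ('a \<Rightarrow> ereal) \<Rightarrow> ('a \<Rightarrow> 'a) \<Rightarrow> 'a \<Rightarrow> 'a"
  where "davis_yin t f g dh x =
    x + prox t g (2 *\<^sub>R prox t f x - x - t *\<^sub>R dh (prox t f x)) - prox t f x"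

text \<open>The three affine minorants add up to a constant, since their slopes cancel.\<close>

lemma subdifferential_sum_minimizer:
  fixes h :: "'a::real_inner \<Rightarrow> real"
  assumes "convex_on UNIV h" "\<And>x. GDERIV h x :> dh x"
    and "u \<in> subdifferential f p" "v \<in> subdifferential g p" "u + v + dh p = 0"
  shows "is_arg_min (\<lambda>w. f w + g w + ereal (h w)) (\<lambda>_. True) p"
proof -
  obtain r where r: "f p = ereal r" "\<And>y. ereal (r + u \<bullet> (y - p)) \<le> f y"
    using assms(3) by (rule subdifferentialD) auto
  obtain s where s: "g p = ereal s" "\<And>y. ereal (s + v \<bullet> (y - p)) \<le> g y"
    using assms(4) by (rule subdifferentialD) auto
  have "f p + g p + ereal (h p) \<le> f w + g w + ereal (h w)" for w
  proof -
    have "u \<bullet> (w - p) + v \<bullet> (w - p) + dh p \<bullet> (w - p) = 0"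
      unfolding inner_add_left[symmetric] assms(5) by simp
    then have "f p + g p + ereal (h p) = ereal (r + u \<bullet> (w - p)) + ereal (s + v \<bullet> (w - p))
        + ereal (h p + dh p \<bullet> (w - p))"
      by (simp add: r(1) s(1))
    also have "\<dots> \<le> f w + g w + ereal (h w)"
      using convex_gradient_inequality[OF assms(1,2), of p w] by (intro add_mono r s) auto
    finally show ?thesis .
  qed
  then show ?thesis by (simp add: is_arg_min_def not_less)
qed

text \<open>\<open>solvable\<close> asks for a zero of the sum of the subdifferentials: a minimizer
  alone need not split into subgradients without a constraint qualification. It also supplies the
  subgradients behind the existence of both proximal points.\<close>

locale davis_yin_problem =
  fixes f g :: "'a::euclidean_space \<Rightarrow> ereal" and h :: "'a \<Rightarrow> real" and dh :: "'a \<Rightarrow> 'a"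
    and L t :: real
  assumes f: "proper_fun f" "lsc_fun f" "convex_fun f"
    and g: "proper_fun g" "lsc_fun g" "convex_fun g"
    and h: "convex_on UNIV h" "smooth_with L h dh"
    and t: "0 < t" "t < 2 / L"
    and solvable: "\<exists>p. \<exists>u\<in>subdifferential f p. \<exists>v\<in>subdifferential g p. u + v + dh p = 0"
begin

lemma grad: "GDERIV h x :> dh x" and lip: "L-lipschitz_on UNIV dh"
  using h by (auto simp: smooth_with_def)

text \<open>As \<open>2 / 0 = 0\<close>, the condition \<open>0 < t < 2 / L\<close> excludes
  \<open>L = 0\<close> as well as negative \<open>L\<close>.\<close>

lemma L_pos: "0 < L"
proof -
  have "0 < 2 / L" using t by linarith
  then show ?thesis by (simp add: zero_less_divide_iff)
qed

lemma prox_f: "(1 / t) *\<^sub>R (x - prox t f x) \<in> subdifferential f (prox t f x)"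
  and prox_g: "(1 / t) *\<^sub>R (x - prox t g x) \<in> subdifferential g (prox t g x)"
  using solvable by (auto intro: prox_subgradient f g t)

lemma prox_f_nonexpansive: "norm (prox t f a - prox t f b) \<le> norm (a - b)"
  and prox_g_nonexpansive: "norm (prox t g a - prox t g b) \<le> norm (a - b)"
  by (auto intro!: monotone_resolvent_nonexpansive[OF t(1)] subdifferential_monotone[OF prox_f prox_f]
      subdifferential_monotone[OF prox_g prox_g])

lemma dh_lipschitz: "norm (dh a - dh b) \<le> L * norm (a - b)"
  using lipschitz_onD[OF lip, of a b] by (simp add: dist_norm)

lemma davis_yin_averaged:
  "(norm (davis_yin t f g dh a - davis_yin t f g dh b))\<^sup>2
    + (1 - t * L / 2) * (norm ((a - davis_yin t f g dh a) - (b - davis_yin t f g dh b)))\<^sup>2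
    \<le> (norm (a - b))\<^sup>2"
proof -
  define y z where "y c = prox t f c" and "z c = prox t g (2 *\<^sub>R y c - c - t *\<^sub>R dh (y c))" for c
  have dy: "davis_yin t f g dh c = c + z c - y c" for c
    by (simp add: davis_yin_def y_def z_def)
  have unscale: "0 \<le> (u - v) \<bullet> c" if "((1 / t) *\<^sub>R u - (1 / t) *\<^sub>R v) \<bullet> c \<ge> 0" for u v c :: 'a
    using that t(1) by (simp add: zero_le_divide_iff flip: scaleR_right_diff_distrib)
  define Y Z U H where "Y = y a - y b" and "Z = z a - z b" and "U = (a - y a) - (b - y b)"
    and "H = dh (y a) - dh (y b)"
  have "0 \<le> U \<bullet> Y" unfolding U_def Y_def y_def
    by (rule unscale[OF subdifferential_monotone[OF prox_f prox_f]])
  moreover have "0 \<le> (Y - U - t *\<^sub>R H - Z) \<bullet> Z"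
  proof -
    \<comment> \<open>Each bracket is \<open>t\<close> times the subgradient of \<open>g\<close>
      that the second proximal step produces.\<close>
    have "Y - U - t *\<^sub>R H - Z = (2 *\<^sub>R y a - a - t *\<^sub>R dh (y a) - z a) - (2 *\<^sub>R y b - b - t *\<^sub>R dh (y b) - z b)"
      by (simp add: Y_def U_def H_def Z_def algebra_simps scaleR_2)
    then show ?thesis
      using unscale[OF subdifferential_monotone[OF prox_g[of "2 *\<^sub>R y a - a - t *\<^sub>R dh (y a)"]
          prox_g[of "2 *\<^sub>R y b - b - t *\<^sub>R dh (y b)"]]]
      by (simp only: Z_def z_def)
  qed
  moreover have "(norm H)\<^sup>2 / L \<le> H \<bullet> Y"
    unfolding H_def Y_def by (rule baillon_haddad[OF h(1) grad lip L_pos])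
  ultimately have "(norm (Z + U))\<^sup>2 + (1 - t * L / 2) * (norm (Y - Z))\<^sup>2 \<le> (norm (Y + U))\<^sup>2"
    by (rule davis_yin_inequality[OF L_pos t(1)])
  moreover have "Z + U = davis_yin t f g dh a - davis_yin t f g dh b"
    "Y - Z = (a - davis_yin t f g dh a) - (b - davis_yin t f g dh b)" "Y + U = a - b"
    by (simp_all add: dy Y_def Z_def U_def)
  ultimately show ?thesis by simp
qed

text \<open>The point \<open>p + t *\<^sub>R u\<close> is fixed: the first proximal step returns
  \<open>p\<close>, and the second is then applied to \<open>p + t *\<^sub>R v\<close>, whose
  proximal point is \<open>p\<close> again.\<close>

lemma davis_yin_fixed_point_exists: "\<exists>q. davis_yin t f g dh q = q"
proof -
  obtain p u v where uv: "u \<in> subdifferential f p" "v \<in> subdifferential g p" "u + v + dh p = 0"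
    using solvable by blast
  have "prox t f (p + t *\<^sub>R u) = p"
    using uv t by (intro prox_eqI) auto
  moreover have "prox t g (2 *\<^sub>R p - (p + t *\<^sub>R u) - t *\<^sub>R dh p) = p"
  proof (intro prox_eqI t)
    have "v = - u - dh p" using uv(3) by (simp add: algebra_simps add_eq_0_iff)
    then have "(1 / t) *\<^sub>R (2 *\<^sub>R p - (p + t *\<^sub>R u) - t *\<^sub>R dh p - p) = v"
      using t by (simp add: scaleR_2 algebra_simps)
    with uv show "(1 / t) *\<^sub>R (2 *\<^sub>R p - (p + t *\<^sub>R u) - t *\<^sub>R dh p - p) \<in> subdifferential g p" by simp
  qed
  ultimately have "davis_yin t f g dh (p + t *\<^sub>R u) = p + t *\<^sub>R u"
    by (simp add: davis_yin_def)
  then show ?thesis by blast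
qed

text \<open>At a fixed point both proximal steps return the same \<open>p\<close>, and the
  subgradients they produce there sum to \<open>- dh p\<close>.\<close>

lemma davis_yin_fixed_point_minimizer:
  assumes "davis_yin t f g dh q = q"
  shows "is_arg_min (\<lambda>w. f w + g w + ereal (h w)) (\<lambda>_. True) (prox t f q)"
proof -
  define p where "p = prox t f q"
  have pg: "prox t g (2 *\<^sub>R p - q - t *\<^sub>R dh p) = p"
    using assms by (simp add: davis_yin_def p_def algebra_simps)
  have "(1 / t) *\<^sub>R (q - p) + (1 / t) *\<^sub>R (2 *\<^sub>R p - q - t *\<^sub>R dh p - p) + dh p = 0"
    using t by (simp add: scaleR_2 algebra_simps)
  from subdifferential_sum_minimizer[OF h(1) grad prox_f[of q, folded p_def]
      prox_g[of "2 *\<^sub>R p - q - t *\<^sub>R dh p", unfolded pg] this]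
  show ?thesis by (simp add: p_def)
qed

end

text \<open>The limit \<open>x'\<close> satisfies \<open>x' = p + t *\<^sub>R u\<close> with
  \<open>p = prox t f x'\<close> and \<open>u\<close> a subgradient of \<open>f\<close> at
  \<open>p\<close>; so the minimizer is in general not \<open>x'\<close> but its image
  \<open>p\<close>, to which \<open>y\<close> converges. Nonzero denominators make the HJ-Prox
  quotients genuine means.\<close>

theorem theorem5:
  fixes f g :: "real ^ 'n \<Rightarrow> ereal"
    and h :: "real ^ 'n \<Rightarrow> real"
    and dh :: "real ^ 'n \<Rightarrow> real ^ 'n"
    and L t :: real
    and \<delta> :: "nat \<Rightarrow> real"
    and x y z :: "nat \<Rightarrow> real ^ 'n"
  assumes f: "proper_fun f" "lsc_fun f" "convex_fun f"
    and g: "proper_fun g" "lsc_fun g" "convex_fun g"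
    and h: "convex_on UNIV h" "smooth_with L h dh"
    and t: "0 < t" "t < 2 / L"
    and \<delta>_pos: "\<And>k. k \<ge> 1 \<Longrightarrow> \<delta> k > 0"
    and \<delta>_summable: "summable (\<lambda>k. sqrt (\<delta> k))"
    and solvable: "\<exists>p. \<exists>u\<in>subdifferential f p. \<exists>v\<in>subdifferential g p. u + v + dh p = 0"
    and f_defined: "\<And>k. k \<ge> 1 \<Longrightarrow> hj_denominator (\<delta> k) t f (x k) \<noteq> 0"
    and g_defined: "\<And>k. k \<ge> 1 \<Longrightarrow>
        hj_denominator (\<delta> k) t g (2 *\<^sub>R y (k + 1) - x k - t *\<^sub>R dh (y (k + 1))) \<noteq> 0"
    and y_step: "\<And>k. k \<ge> 1 \<Longrightarrow> y (k + 1) = hj_prox (\<delta> k) t f (x k)"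
    and z_step: "\<And>k. k \<ge> 1 \<Longrightarrow>
        z (k + 1) = hj_prox (\<delta> k) t g (2 *\<^sub>R y (k + 1) - x k - t *\<^sub>R dh (y (k + 1)))"
    and x_step: "\<And>k. k \<ge> 1 \<Longrightarrow> x (k + 1) = x k + z (k + 1) - y (k + 1)"
  shows "\<exists>x'. x \<longlonglongrightarrow> x' \<and>
           is_arg_min (\<lambda>u. f u + g u + ereal (h u)) (\<lambda>_. True) (prox t f x') \<and>
           y \<longlonglongrightarrow> prox t f x'"
proof -
  interpret davis_yin_problem f g h dh L t
    by standard (use assms in auto)
  define T where "T = davis_yin t f g dh"
  define C where "C = sqrt (8 * t * 2 ^ DIM(real ^ 'n))"
  define \<epsilon> where "\<epsilon> k = C * sqrt (\<delta> (Suc k))" for k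
  have \<epsilon>: "summable \<epsilon>"
    unfolding \<epsilon>_def using \<delta>_summable by (intro summable_mult) (subst summable_Suc_iff)
  \<comment> \<open>The recursion starts at index 1, and \<open>y (k + 1)\<close> is computed from
    \<open>x k\<close>; the shifts by one and by two pair \<open>Y k\<close> with
    \<open>X k\<close>.\<close>
  define X Y where "X k = x (Suc k)" and "Y k = y (Suc (Suc k))" for k
  have Yerr: "norm (Y k - prox t f (X k)) \<le> \<epsilon> k" for k
    using hj_prox_error[OF f(1,3) t(1) \<delta>_pos[of "Suc k"] prox_f f_defined[of "Suc k"]] y_step[of "Suc k"]
    by (simp add: X_def Y_def \<epsilon>_def C_def)
  \<comment> \<open>The factor is 1 for the error of the second HJ-Prox, \<open>2 + t * L\<close>
    for its displaced argument, and 1 for the error of the first.\<close>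
  have Xerr: "norm (X (Suc k) - T (X k)) \<le> (4 + t * L) * \<epsilon> k" for k
  proof -
    define p where "p = prox t f (X k)"
    define a b where "a = 2 *\<^sub>R Y k - X k - t *\<^sub>R dh (Y k)" and "b = 2 *\<^sub>R p - X k - t *\<^sub>R dh p"
    have Zerr: "norm (z (Suc (Suc k)) - prox t g a) \<le> \<epsilon> k"
      using hj_prox_error[OF g(1,3) t(1) \<delta>_pos[of "Suc k"] prox_g g_defined[of "Suc k"]] z_step[of "Suc k"]
      by (simp add: X_def Y_def \<epsilon>_def C_def a_def)
    have "norm (prox t g a - prox t g b) \<le> norm (a - b)" by (rule prox_g_nonexpansive)
    also have "a - b = 2 *\<^sub>R (Y k - p) - t *\<^sub>R (dh (Y k) - dh p)"
      by (simp add: a_def b_def algebra_simps)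
    also have "norm \<dots> \<le> 2 * norm (Y k - p) + t * norm (dh (Y k) - dh p)"
      using norm_triangle_ineq4[of "2 *\<^sub>R (Y k - p)" "t *\<^sub>R (dh (Y k) - dh p)"] t by simp
    also have "\<dots> \<le> 2 * norm (Y k - p) + t * (L * norm (Y k - p))"
      using t by (intro add_left_mono mult_left_mono dh_lipschitz) auto
    also have "\<dots> = (2 + t * L) * norm (Y k - p)" by (simp add: algebra_simps)
    also have "\<dots> \<le> (2 + t * L) * \<epsilon> k"
      using Yerr[of k] t L_pos by (intro mult_left_mono) (auto simp: p_def)
    finally have ab: "norm (prox t g a - prox t g b) \<le> (2 + t * L) * \<epsilon> k" .
    have "X (Suc k) - T (X k)
        = (z (Suc (Suc k)) - prox t g a) + (prox t g a - prox t g b) - (Y k - p)"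
      using x_step[of "Suc k"] by (simp add: T_def davis_yin_def X_def Y_def p_def b_def)
    also have "norm \<dots> \<le> norm (z (Suc (Suc k)) - prox t g a) + norm (prox t g a - prox t g b) + norm (Y k - p)"
      by (rule order_trans[OF norm_triangle_ineq4]) (intro add_right_mono norm_triangle_ineq)
    also have "\<dots> \<le> \<epsilon> k + (2 + t * L) * \<epsilon> k + \<epsilon> k"
      using Yerr[of k] by (intro add_mono Zerr ab) (simp add: p_def)
    finally show ?thesis by (simp add: algebra_simps)
  qed
  have "0 < 1 - t * L / 2" using t L_pos by (simp add: field_simps)
  moreover obtain q where "T q = q"
    using davis_yin_fixed_point_exists by (auto simp: T_def)
  ultimately obtain x' where x': "T x' = x'" "X \<longlonglongrightarrow> x'"
    using krasnoselskii_mann_inexact[of _ T q X, OF _ _ _ Xerr summable_mult[OF \<epsilon>]] davis_yin_averaged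
    unfolding T_def by blast
  \<comment> \<open>\<open>Y k\<close> differs from \<open>prox t f (X k)\<close> by at most
    \<open>\<epsilon> k\<close>, and nonexpansiveness carries the convergence of \<open>X\<close>
    over to these proximal points.\<close>
  have "(\<lambda>k. norm (X k - x')) \<longlonglongrightarrow> 0"
    using x'(2) by (simp add: tendsto_norm_zero_iff LIM_zero_iff)
  then have "(\<lambda>k. prox t f (X k) - prox t f x') \<longlonglongrightarrow> 0"
    by (rule Lim_null_comparison[OF always_eventually, rotated]) (intro allI prox_f_nonexpansive)
  moreover have "(\<lambda>k. Y k - prox t f (X k)) \<longlonglongrightarrow> 0"
    by (rule Lim_null_comparison[OF always_eventually summable_LIMSEQ_zero[OF \<epsilon>]]) (intro allI Yerr)
  ultimately have "(\<lambda>k. (Y k - prox t f (X k)) + (prox t f (X k) - prox t f x')) \<longlonglongrightarrow> 0 + 0"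
    by (intro tendsto_add)
  then have "Y \<longlonglongrightarrow> prox t f x'" by (simp add: LIM_zero_iff)
  then have "y \<longlonglongrightarrow> prox t f x'"
    unfolding Y_def using filterlim_sequentially_Suc[of "\<lambda>k. y (Suc k)"] filterlim_sequentially_Suc[of y] by simp
  moreover have "x \<longlonglongrightarrow> x'"
    using x'(2) unfolding X_def using filterlim_sequentially_Suc[of x] by simp
  ultimately show ?thesis
    using davis_yin_fixed_point_minimizer[of x'] x'(1) by (auto simp: T_def)
qed

end
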